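(* Let $N\ge1$ and let $\theta_N$ be a number such that $\|f\|_0+\|\hat f\|_0\ge N-\theta_N$ holds for all non-zero $f\in\mathbb{C}^N$. Let $g\in\mathbb{C}^N$ have the following property: for each $p\in\mathbb{Z}_N$, the sequence $c_p=(\langle g,g_{p,\ell}\rangle)_{\ell\in\mathbb{Z}_N}$ obeys $$\theta_N+K+1\le\|c_p\|_0\le\hat k$$ for some positive integers $K$ and $\hat k$ (independent of $p$). Then, for any subsets $A\subseteq\mathbb{Z}_N$, $B\subseteq\mathbb{Z}_N$ with $$|A|\ge\theta_N+\hat k+1,\qquad|B|\ge\theta_N+K^2-K+2,$$ the following holds: if a matrix $H\in\mathfrak{H}_K$ satisfies $\langle g_\lambda g_\lambda^*,H\rangle_{HS}=0$ for all $\lambda\in A\times B$, then $H=0$.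
   Context: Vectors in $\mathbb{C}^N$ and rows/columns of $N\times N$ matrices are indexed by $\mathbb{Z}_N=\mathbb{Z}/N\mathbb{Z}$; $\omega=e^{2\pi i/N}$. $\|f\|_0$ is the number of non-zero entries of $f$, and $\hat f(j)=\sum_{n=0}^{N-1}f(n)\omega^{-nj}$ is the discrete Fourier transform. Scalar products: $\langle x,y\rangle=\sum_{j\in\mathbb{Z}_N}\overline{x(j)}\,y(j)$ and $\langle A,B\rangle_{HS}=\mathrm{tr}(A^*B)$. Translations and modulations are $(T_px)(n)=x(n-p)$ and $(M_\ell x)(n)=\omega^{\ell n}x(n)$. For $\lambda=(p,\ell)\in\mathbb{Z}_N^2$ put $g_\lambda=g_{p,\ell}=M_\ell T_pg$ (so in $A\times B$, the set $A$ contains translation parameters and $B$ modulation parameters). The class $\mathfrak{H}_K$ consists of all $H\in\mathbb{C}^{N\times N}$ for which there exists an index set $\mathcal{K}$ with $|\mathcal{K}|=K$ such that $H_{ij}=0$ whenever $(i,j)\notin\mathcal{K}\times\mathcal{K}$. *)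

theory Defs
  imports "HOL-Analysis.Analysis" "Berlekamp_Zassenhaus.Finite_Field"
begin

text \<open>
  The index set \<open>\<int>/N\<int>\<close> is the type \<open>'n mod_ring\<close> with \<open>N = CARD('n)\<close>; an arbitrary finite type
  \<open>'n\<close> gives every \<open>N \<ge> 1\<close>. Differences of indices are thus taken modulo \<open>N\<close>. Exponents of
  \<open>\<omega>\<close> are formed from the representatives in \<open>{0..<N}\<close>; the values do not depend on that
  choice, since \<open>\<omega>\<close> is an \<open>N\<close>-th root of unity.
\<close>

type_synonym 'n cvec = "complex ^ ('n mod_ring)"
type_synonym 'n cmat = "complex ^ ('n mod_ring) ^ ('n mod_ring)"

definition omega :: "nat \<Rightarrow> complex" where
  "omega N = exp (2 * of_real pi * \<i> / of_nat N)"

definition norm0 :: "('n::finite) cvec \<Rightarrow> nat" where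
  "norm0 f = card {j. f $ j \<noteq> 0}"

definition dft :: "('n::finite) cvec \<Rightarrow> 'n cvec" where
  "dft f = (\<chi> j. \<Sum>n\<in>UNIV. f $ n * omega CARD('n) powi (- (to_int_mod_ring n * to_int_mod_ring j)))"

text \<open>Conjugate-linear in the first argument, unlike the library's real inner product \<open>\<bullet>\<close>.\<close>

definition scalar_prod :: "('n::finite) cvec \<Rightarrow> 'n cvec \<Rightarrow> complex" where
  "scalar_prod x y = (\<Sum>j\<in>UNIV. cnj (x $ j) * y $ j)"

definition adjoint_mat :: "('n::finite) cmat \<Rightarrow> 'n cmat" where
  "adjoint_mat A = (\<chi> i j. cnj (A $ j $ i))"

definition hs_prod :: "('n::finite) cmat \<Rightarrow> 'n cmat \<Rightarrow> complex" where
  "hs_prod A B = trace (adjoint_mat A ** B)"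

definition translation :: "'n mod_ring \<Rightarrow> ('n::finite) cvec \<Rightarrow> 'n cvec" where
  "translation p x = (\<chi> n. x $ (n - p))"

definition modulation :: "'n mod_ring \<Rightarrow> ('n::finite) cvec \<Rightarrow> 'n cvec" where
  "modulation l x = (\<chi> n. omega CARD('n) powi (to_int_mod_ring l * to_int_mod_ring n) * x $ n)"

definition gabor :: "('n::finite) cvec \<Rightarrow> 'n mod_ring \<times> 'n mod_ring \<Rightarrow> 'n cvec" where
  "gabor g lam = modulation (snd lam) (translation (fst lam) g)"

definition rank_one :: "('n::finite) cvec \<Rightarrow> 'n cmat" where
  "rank_one x = (\<chi> i j. x $ i * cnj (x $ j))"

definition sparse_class :: "nat \<Rightarrow> ('n::finite) cmat set" where
  "sparse_class K = {H. \<exists>S :: 'n mod_ring set. card S = K \<and>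
     (\<forall>i j. (i, j) \<notin> S \<times> S \<longrightarrow> H $ i $ j = 0)}"

end

theory Submission
  imports Defs
begin

text \<open>
  Put \<open>z\<^sub>p(d) = \<Sum>i. g(i - p) \<sqdot> cnj (g(i - p + d)) \<sqdot> H(i + d, i)\<close>, which groups the entries of \<open>H\<close> along
  its diagonals \<open>d\<close>. The two parameters of \<open>A \<times> B\<close> then act separately:

    \<^item> For fixed \<open>p\<close>, the measurements \<open>l \<mapsto> \<langle>g\<^bsub>p,l\<^esub> g\<^bsub>p,l\<^esub>\<^sup>*, H\<rangle>\<close> form the Fourier transform of \<open>z\<^sub>p\<close>
      (\<open>hs_prod_gabor_eq_dft\<close>). A matrix supported on \<open>S \<times> S\<close> has non-zero entries only on the
      diagonals \<open>d \<in> S - S\<close>, of which there are at most \<open>K\<^sup>2 - K + 1\<close>. Vanishing on \<open>B\<close> therefore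
      forces \<open>z\<^sub>p = 0\<close> for every \<open>p \<in> A\<close>, by the uncertainty principle.

    \<^item> For fixed \<open>d\<close>, the function \<open>p \<mapsto> z\<^sub>p(d)\<close> is a correlation of the diagonal
      \<open>h(i) = H(i + d, i)\<close> with \<open>m \<mapsto> g(m) \<sqdot> cnj (g(m + d))\<close>. Its Fourier transform is the pointwise product
      of \<open>dft h\<close> with, up to phases, \<open>c\<^sub>d\<close> (\<open>dft_correlation\<close>, \<open>scalar_prod_gabor\<close>). So it has at most
      \<open>k\<close> non-zero Fourier coefficients, and it vanishes on \<open>A\<close> by the first point; the uncertainty
      principle makes it zero for all \<open>p\<close>. Hence \<open>dft h\<close> vanishes wherever \<open>c\<^sub>d\<close> does not, that is at
      \<open>\<theta> + K + 1\<close> points or more, while \<open>h\<close> has at most \<open>K\<close> non-zero entries. A third application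
      of the uncertainty principle gives \<open>h = 0\<close>. As \<open>d\<close> was arbitrary, \<open>H = 0\<close>.
\<close>

section \<open>The standard character of the cyclic group\<close>

text \<open>
  Working with \<open>\<omega>\<^sup>x\<close> for \<open>x\<close> in the cyclic group itself, instead of with exponents that are
  representatives, leaves all further phase computations to the ring identities of the indices.
\<close>

definition chi :: "('n::finite) mod_ring \<Rightarrow> complex" where
  "chi x = omega CARD('n) powi to_int_mod_ring x"

lemma omega_nonzero [simp]: "omega N \<noteq> 0"
  by (simp add: omega_def)

lemma omega_power_self: "N > 0 \<Longrightarrow> omega N ^ N = 1"
  by (simp add: omega_def flip: exp_of_nat_mult)

lemma omega_powi_mod:
  assumes "N > 0"
  shows "omega N powi (a mod int N) = omega N powi a"
proof -
  have "omega N powi (int N * q + r) = omega N powi r" for q r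
    using assms by (simp add: power_int_add power_int_mult omega_power_self)
  then show ?thesis
    by (metis mult_div_mod_eq)
qed

lemma cnj_omega: "cnj (omega N) = inverse (omega N)"
  by (simp add: omega_def exp_cnj flip: exp_minus)

lemma chi_nonzero [simp]: "chi x \<noteq> 0"
  by (simp add: chi_def)

lemma chi_add: "chi (x + y) = chi x * chi (y :: ('n::finite) mod_ring)"
  by (simp add: chi_def to_int_mod_ring_add omega_powi_mod power_int_add)

lemma chi_0 [simp]: "chi (0 :: ('n::finite) mod_ring) = 1"
  by (simp add: chi_def)

lemma chi_minus: "chi (- x) = inverse (chi (x :: ('n::finite) mod_ring))"
  using chi_add[of x "- x"] by (simp add: inverse_unique)

lemma cnj_chi: "cnj (chi x) = chi (- x)"
  by (simp add: chi_minus) (simp add: chi_def cnj_omega power_int_inverse)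

lemma omega_powi_to_int_mult:
  fixes x y :: "('n::finite) mod_ring"
  shows "omega CARD('n) powi (to_int_mod_ring x * to_int_mod_ring y) = chi (x * y)"
  by (simp add: chi_def to_int_mod_ring_mult omega_powi_mod)

lemma dft_eq_chi: "dft f $ j = (\<Sum>n\<in>UNIV. f $ n * chi (- (n * j)))"
  by (simp add: dft_def power_int_minus omega_powi_to_int_mult chi_minus)

lemma gabor_nth: "gabor g (p, l) $ n = chi (l * n) * g $ (n - p)"
  by (simp add: gabor_def modulation_def translation_def omega_powi_to_int_mult)

lemma sum_shift:
  fixes f :: "('n::finite) mod_ring \<Rightarrow> 'b::comm_monoid_add"
  shows "(\<Sum>j\<in>UNIV. f j) = (\<Sum>m\<in>UNIV. f (m + a))"
  by (rule sum.reindex_bij_witness[of _ "\<lambda>m. m + a" "\<lambda>j. j - a"]) auto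

section \<open>Separating time and frequency\<close>

lemma hs_prod_rank_one:
  "hs_prod (rank_one x) H = (\<Sum>i\<in>UNIV. \<Sum>j\<in>UNIV. x $ i * cnj (x $ j) * H $ j $ i)"
  by (simp add: hs_prod_def trace_def matrix_matrix_mult_def adjoint_mat_def rank_one_def
      mult.commute)

text \<open>
  The entry \<open>(i + d, i)\<close> of \<open>H\<close> meets the modulation only through the phase
  \<open>\<omega>\<^bsup>l i\<^esup> \<sqdot> cnj (\<omega>\<^bsup>l (i + d)\<^esup>) = \<omega>\<^bsup>- l d\<^esup>\<close>, which is constant along the diagonal \<open>d\<close>.
\<close>

lemma hs_prod_gabor_eq_dft:
  fixes g :: "('n::finite) cvec"
  shows "hs_prod (rank_one (gabor g (p, l))) H =
    dft (\<chi> d. \<Sum>i\<in>UNIV. g $ (i - p) * cnj (g $ (i - p + d)) * H $ (i + d) $ i) $ l"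
proof -
  have phase: "chi (l * i) * chi (- (l * (i + d))) = chi (- (d * l))" for i d :: "'n mod_ring"
    by (simp add: algebra_simps flip: chi_add)
  have entry: "gabor g (p, l) $ i * cnj (gabor g (p, l) $ (d + i)) =
      g $ (i - p) * cnj (g $ (i - p + d)) * chi (- (d * l))" for i d
  proof -
    have "gabor g (p, l) $ i * cnj (gabor g (p, l) $ (d + i)) =
        g $ (i - p) * cnj (g $ (i - p + d)) * (chi (l * i) * chi (- (l * (i + d))))"
      by (simp add: gabor_nth cnj_chi add.commute add_diff_eq mult_ac)
    then show ?thesis by (simp only: phase)
  qed
  have "hs_prod (rank_one (gabor g (p, l))) H =
      (\<Sum>i\<in>UNIV. \<Sum>d\<in>UNIV. gabor g (p, l) $ i * cnj (gabor g (p, l) $ (d + i)) * H $ (d + i) $ i)"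
    unfolding hs_prod_rank_one by (intro sum.cong refl sum_shift)
  also have "\<dots> = (\<Sum>i\<in>UNIV. \<Sum>d\<in>UNIV.
      g $ (i - p) * cnj (g $ (i - p + d)) * H $ (i + d) $ i * chi (- (d * l)))"
    by (simp only: entry) (simp add: add.commute mult_ac)
  also have "\<dots> = (\<Sum>d\<in>UNIV. \<Sum>i\<in>UNIV.
      g $ (i - p) * cnj (g $ (i - p + d)) * H $ (i + d) $ i * chi (- (d * l)))"
    by (rule sum.swap)
  finally show ?thesis
    by (simp add: dft_eq_chi sum_distrib_right)
qed

text \<open>
  The Gabor coefficients \<open>c\<^sub>d\<close> are the (reflected) Fourier coefficients of \<open>m \<mapsto> g(m) \<sqdot> cnj (g(m + d))\<close> up
  to a phase, so both vanish at the same frequencies.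
\<close>

lemma scalar_prod_gabor:
  fixes g :: "('n::finite) cvec"
  shows "scalar_prod g (gabor g (d, l)) =
    chi (l * d) * (\<Sum>m\<in>UNIV. g $ m * cnj (g $ (m + d)) * chi (l * m))"
proof -
  have "scalar_prod g (gabor g (d, l)) = (\<Sum>m\<in>UNIV. cnj (g $ (m + d)) * (chi (l * (m + d)) * g $ m))"
    unfolding scalar_prod_def
    by (subst sum_shift[of _ d]) (simp add: gabor_nth)
  then show ?thesis
    by (simp add: distrib_left chi_add sum_distrib_left mult_ac)
qed

text \<open>
  This is the convolution theorem; \<open>u\<close> is reflected, which conjugates the character in its transform.
\<close>

lemma dft_correlation:
  fixes u h :: "('n::finite) cvec"
  shows "dft (\<chi> p. \<Sum>i\<in>UNIV. u $ (i - p) * h $ i) $ s = dft h $ s * (\<Sum>m\<in>UNIV. u $ m * chi (s * m))"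
proof -
  have inner: "(\<Sum>p\<in>UNIV. u $ (i - p) * h $ i * chi (- (p * s))) =
      h $ i * chi (- (i * s)) * (\<Sum>m\<in>UNIV. u $ m * chi (s * m))" for i
  proof -
    have "(\<Sum>p\<in>UNIV. u $ (i - p) * h $ i * chi (- (p * s))) =
        (\<Sum>m\<in>UNIV. u $ m * h $ i * chi (- ((i - m) * s)))"
      by (rule sum.reindex_bij_witness[of _ "\<lambda>m. i - m" "\<lambda>p. i - p"]) auto
    also have "\<dots> = (\<Sum>m\<in>UNIV. h $ i * chi (- (i * s)) * (u $ m * chi (s * m)))"
    proof (rule sum.cong[OF refl])
      fix m
      have "chi (- ((i - m) * s)) = chi (- (i * s)) * chi (s * m)"
        by (simp add: algebra_simps flip: chi_add)
      then show "u $ m * h $ i * chi (- ((i - m) * s)) =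
          h $ i * chi (- (i * s)) * (u $ m * chi (s * m))"
        by (simp add: mult_ac)
    qed
    finally show ?thesis by (simp add: sum_distrib_left)
  qed
  have "dft (\<chi> p. \<Sum>i\<in>UNIV. u $ (i - p) * h $ i) $ s =
      (\<Sum>p\<in>UNIV. \<Sum>i\<in>UNIV. u $ (i - p) * h $ i * chi (- (p * s)))"
    by (simp add: dft_eq_chi sum_distrib_right)
  also have "\<dots> = (\<Sum>i\<in>UNIV. \<Sum>p\<in>UNIV. u $ (i - p) * h $ i * chi (- (p * s)))"
    by (rule sum.swap)
  finally show ?thesis
    by (simp add: inner dft_eq_chi sum_distrib_right)
qed

section \<open>Uniqueness\<close>

lemma uncertainty_imp_zero:
  fixes f :: "('n::finite) cvec" and \<theta> :: real
  assumes uncertainty: "f \<noteq> 0 \<Longrightarrow> real (norm0 f) + real (norm0 (dft f)) \<ge> real CARD('n) - \<theta>"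
    and time: "\<And>j. j \<notin> U \<Longrightarrow> f $ j = 0"
    and freq: "\<And>j. j \<notin> V \<Longrightarrow> dft f $ j = 0"
    and small: "real (card U) + real (card V) < real CARD('n) - \<theta>"
  shows "f = 0"
proof (rule ccontr)
  assume "f \<noteq> 0"
  moreover have "norm0 f \<le> card U" "norm0 (dft f) \<le> card V"
    unfolding norm0_def using time freq by (auto intro!: card_mono)
  ultimately show False
    using uncertainty small by linarith
qed

lemma card_Compl_mod_ring: "real (card (- X)) = real CARD('n) - real (card (X :: ('n::finite) mod_ring set))"
proof -
  have "card X \<le> CARD('n)"
    using card_mono[of UNIV X] by simp
  then show ?thesis
    by (simp add: Compl_eq_Diff_UNIV card_Diff_subset of_nat_diff)
qed

text \<open>
  The pairs on the diagonal of \<open>S \<times> S\<close> all give the difference \<open>0\<close>, so they count only once.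
\<close>

lemma card_differences_le:
  fixes S :: "('a::{finite, group_add}) set"
  shows "card {x - y |x y. x \<in> S \<and> y \<in> S} \<le> card S * card S - card S + 1"
proof -
  have "{x - y |x y. x \<in> S \<and> y \<in> S} \<subseteq> insert 0 ((\<lambda>(x, y). x - y) ` (S \<times> S - (\<lambda>x. (x, x)) ` S))"
    by force
  then have "card {x - y |x y. x \<in> S \<and> y \<in> S}
      \<le> card (insert 0 ((\<lambda>(x, y). x - y) ` (S \<times> S - (\<lambda>x. (x, x)) ` S)))"
    by (intro card_mono) auto
  also have "\<dots> \<le> Suc (card ((\<lambda>(x, y). x - y) ` (S \<times> S - (\<lambda>x. (x, x)) ` S)))"
    by (intro card_insert_le_m1) auto
  also have "\<dots> \<le> Suc (card (S \<times> S - (\<lambda>x. (x, x)) ` S))"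
    by (simp add: card_image_le)
  also have "card (S \<times> S - (\<lambda>x. (x, x)) ` S) = card S * card S - card S"
    by (subst card_Diff_subset) (auto simp: card_cartesian_product card_image inj_on_def)
  finally show ?thesis by simp
qed

theorem theorem3p2:
  fixes g :: "complex ^ (('n::finite) mod_ring)"
    and \<theta> :: real
    and K k :: nat
    and A B :: "'n mod_ring set"
    and H :: "complex ^ ('n mod_ring) ^ ('n mod_ring)"
  assumes uncertainty: "\<And>f :: complex ^ ('n mod_ring). f \<noteq> 0 \<Longrightarrow>
      real (norm0 f) + real (norm0 (dft f)) \<ge> real CARD('n) - \<theta>"
    and "K > 0" and "k > 0"
    and c_lower: "\<And>p :: 'n mod_ring.
      \<theta> + real K + 1 \<le> real (norm0 (\<chi> l. scalar_prod g (gabor g (p, l)) :: complex ^ ('n mod_ring)))"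
    and c_upper: "\<And>p :: 'n mod_ring.
      norm0 (\<chi> l. scalar_prod g (gabor g (p, l)) :: complex ^ ('n mod_ring)) \<le> k"
    and card_A: "real (card A) \<ge> \<theta> + real k + 1"
    and card_B: "real (card B) \<ge> \<theta> + (real K)\<^sup>2 - real K + 2"
    and "H \<in> sparse_class K"
    and "\<And>lam. lam \<in> A \<times> B \<Longrightarrow> hs_prod (rank_one (gabor g lam)) H = 0"
  shows "H = 0"
proof -
  obtain S where card_S: "card S = K" and supp: "\<And>i j. (i, j) \<notin> S \<times> S \<Longrightarrow> H $ i $ j = 0"
    using \<open>H \<in> sparse_class K\<close> unfolding sparse_class_def by blast
  define z where "z p d = (\<Sum>i\<in>UNIV. g $ (i - p) * cnj (g $ (i - p + d)) * H $ (i + d) $ i)" for p d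
  define D where "D = {x - y |x y. x \<in> S \<and> y \<in> S}"

  have "card D \<le> K * K - K + 1"
    using card_differences_le[of S] by (simp add: D_def card_S)
  then have "card D + K \<le> K * K + 1"
    using le_square[of K] by linarith
  then have "real (card D + K) \<le> real (K * K + 1)"
    by (simp only: of_nat_le_iff)
  then have card_D: "real (card D) \<le> (real K)\<^sup>2 - real K + 1"
    by (simp add: power2_eq_square)

  have z_on_A: "z p d = 0" if "p \<in> A" for p d
  proof -
    have "(\<chi> d. z p d) = 0"
    proof (rule uncertainty_imp_zero[OF uncertainty, of _ D "- B"])
      fix d assume "d \<notin> D"
      then have "(i + d, i) \<notin> S \<times> S" for i
        unfolding D_def by force
      then show "(\<chi> d. z p d) $ d = 0"
        by (simp add: z_def supp)
    next
      fix l assume "l \<notin> - B"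
      then have "hs_prod (rank_one (gabor g (p, l))) H = 0"
        using \<open>p \<in> A\<close> assms(9) by simp
      then show "dft (\<chi> d. z p d) $ l = 0"
        by (simp add: hs_prod_gabor_eq_dft z_def)
    qed (use card_D card_B in \<open>auto simp: card_Compl_mod_ring\<close>)
    then show ?thesis by (simp add: vec_eq_iff)
  qed

  have diagonal: "H $ (i + d) $ i = 0" for d i
  proof -
    define h :: "complex ^ ('n mod_ring)" where "h = (\<chi> i. H $ (i + d) $ i)"
    define C where "C = {l. scalar_prod g (gabor g (d, l)) \<noteq> 0}"
    have card_C: "\<theta> + real K + 1 \<le> real (card C)" "card C \<le> k"
      using c_lower[of d] c_upper[of d] by (simp_all add: C_def norm0_def)
    have corr: "dft (\<chi> p. z p d) $ s =
        dft h $ s * (\<Sum>m\<in>UNIV. g $ m * cnj (g $ (m + d)) * chi (s * m))" for s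
      using dft_correlation[of "\<chi> m. g $ m * cnj (g $ (m + d))" h s] by (simp add: z_def h_def)

    have "(\<chi> p. z p d) = 0"
    proof (rule uncertainty_imp_zero[OF uncertainty, of _ "- A" C])
      \<comment> \<open>The spectrum is contained in \<open>C\<close> because one factor of the transform is \<open>c\<^sub>d(s)\<close> up to a phase.\<close>
      show "dft (\<chi> p. z p d) $ s = 0" if "s \<notin> C" for s
        using that by (simp add: C_def corr scalar_prod_gabor)
    qed (use z_on_A card_A card_C in \<open>auto simp: card_Compl_mod_ring\<close>)
    then have dft_z: "dft (\<chi> p. z p d) $ s = 0" for s
      by (simp add: dft_def)

    \<comment> \<open>On \<open>C\<close> that factor is non-zero and can be cancelled.\<close>
    have h_dft: "dft h $ s = 0" if "s \<in> C" for s
      using that dft_z[of s] by (simp add: C_def corr scalar_prod_gabor)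
    have "h = 0"
    proof (rule uncertainty_imp_zero[OF uncertainty, of _ S "- C"])
      show "h $ i = 0" if "i \<notin> S" for i
        using that by (simp add: h_def supp)
    qed (use h_dft card_C card_S in \<open>auto simp: card_Compl_mod_ring\<close>)
    then have "h $ i = 0" by simp
    then show ?thesis by (simp add: h_def)
  qed
  show ?thesis
    unfolding vec_eq_iff
  proof (intro allI)
    fix i j
    show "H $ i $ j = 0 $ i $ j"
      using diagonal[of j "i - j"] by simp
  qed
qed

end
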